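(* For $p\neq 0$ let $$x(p)=\frac{(p^2+2p-2)+\sqrt{p^3(p+4)}}{2\sqrt{p^3(p+4)}},\qquad y_0(p)=\frac{(p^2+2p)+\sqrt{p^3(p+4)}}{2\sqrt{p^3(p+4)}},$$ $$y(p)=\frac{\left(p^2+2p+\sqrt{p^3(p+4)}\right)\left(-p^2-4p+3\sqrt{p^3(p+4)}\right)}{4p(p+1)\sqrt{p^3(p+4)}}.$$ Then $y_0(p)$, as a function of $x=x(p)$, is a solution of the Painlevé VI equation with parameters $(\alpha,\beta,\gamma,\delta)=(0,0,0,\tfrac12)$, and $y(p)$, as a function of $x=x(p)$, is a solution of the Painlevé VI equation with parameters $(\alpha,\beta,\gamma,\delta)=(\tfrac18,-\tfrac18,\tfrac18,\tfrac38)$.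
   Context: The Painlevé VI equation with parameters $(\alpha,\beta,\gamma,\delta)\in\mathbb{C}^4$ is $$\frac{d^2 y}{dx^2}=\frac12\left(\frac1y+\frac1{y-1}+\frac1{y-x}\right)\left(\frac{dy}{dx}\right)^2-\left(\frac1x+\frac1{x-1}+\frac1{y-x}\right)\frac{dy}{dx}+\frac{y(y-1)(y-x)}{x^2(x-1)^2}\left(\alpha+\beta\frac{x}{y^2}+\gamma\frac{x-1}{(y-1)^2}+\delta\frac{x(x-1)}{(y-x)^2}\right).$$ The functions are considered locally as (possibly complex-valued) analytic functions of $p$, with the same fixed local branch of $\sqrt{p^3(p+4)}$ in all formulas, at values of $p$ for which all the expressions involved are defined; "as a function of $x(p)$" means via the local inverse of $p\mapsto x(p)$. *)

theory Defs
  imports "HOL-Complex_Analysis.Complex_Analysis"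
begin

definition PVI_defined :: "complex \<Rightarrow> complex \<Rightarrow> bool" where
  "PVI_defined x y \<longleftrightarrow> x \<noteq> 0 \<and> x \<noteq> 1 \<and> y \<noteq> 0 \<and> y \<noteq> 1 \<and> y \<noteq> x"

definition PVI_rhs ::
  "complex \<Rightarrow> complex \<Rightarrow> complex \<Rightarrow> complex \<Rightarrow> complex \<Rightarrow> complex \<Rightarrow> complex \<Rightarrow> complex" where
  "PVI_rhs \<alpha> \<beta> \<gamma> \<delta> x y y' =
     1/2 * (1/y + 1/(y - 1) + 1/(y - x)) * y'^2
     - (1/x + 1/(x - 1) + 1/(y - x)) * y'
     + y * (y - 1) * (y - x) / (x^2 * (x - 1)^2)
       * (\<alpha> + \<beta> * (x / y^2) + \<gamma> * ((x - 1) / (y - 1)^2) + \<delta> * (x * (x - 1) / (y - x)^2))"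

text \<open>Division by zero yields \<open>0\<close> in HOL, so a solution is explicitly required to avoid
  the singular loci of the equation.\<close>

definition PVI_solution_on ::
  "complex \<Rightarrow> complex \<Rightarrow> complex \<Rightarrow> complex \<Rightarrow> complex set \<Rightarrow> (complex \<Rightarrow> complex) \<Rightarrow> bool" where
  "PVI_solution_on \<alpha> \<beta> \<gamma> \<delta> U u \<longleftrightarrow>
     open U \<and> u holomorphic_on U \<and>
     (\<forall>x\<in>U. PVI_defined x (u x) \<and> deriv (deriv u) x = PVI_rhs \<alpha> \<beta> \<gamma> \<delta> x (u x) (deriv u x))"

definition local_inverse ::
  "(complex \<Rightarrow> complex) \<Rightarrow> complex set \<Rightarrow> complex set \<Rightarrow> (complex \<Rightarrow> complex) \<Rightarrow> bool" where
  "local_inverse X V T q \<longleftrightarrow> open V \<and> open T \<and> homeomorphism V T X q"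

text \<open>The function \<open>Y(p)\<close>, regarded as a function of \<open>x = X(p)\<close> for \<open>p\<close> in \<open>D\<close>: near every
  point at which the equation is defined, \<open>X\<close> has a local inverse \<open>q\<close>, and for every local
  inverse \<open>q\<close> of \<open>X\<close> avoiding the singular loci, \<open>Y \<circ> q\<close> is a solution on the domain of \<open>q\<close>.\<close>

definition PVI_parametric_solution ::
  "complex \<Rightarrow> complex \<Rightarrow> complex \<Rightarrow> complex \<Rightarrow> complex set \<Rightarrow>
   (complex \<Rightarrow> complex) \<Rightarrow> (complex \<Rightarrow> complex) \<Rightarrow> bool" where
  "PVI_parametric_solution \<alpha> \<beta> \<gamma> \<delta> D X Y \<longleftrightarrow>
     (\<forall>p\<in>D. PVI_defined (X p) (Y p) \<longrightarrow>
        (\<exists>V T q. p \<in> V \<and> V \<subseteq> D \<and> (\<forall>v\<in>V. PVI_defined (X v) (Y v)) \<and> local_inverse X V T q)) \<and>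
     (\<forall>V T q. V \<subseteq> D \<and> (\<forall>v\<in>V. PVI_defined (X v) (Y v)) \<and> local_inverse X V T q \<longrightarrow>
        PVI_solution_on \<alpha> \<beta> \<gamma> \<delta> T (Y \<circ> q))"

definition sqrt_branch_on :: "complex set \<Rightarrow> (complex \<Rightarrow> complex) \<Rightarrow> bool" where
  "sqrt_branch_on D s \<longleftrightarrow>
     open D \<and> s holomorphic_on D \<and> (\<forall>p\<in>D. (s p)^2 = p^3 * (p + 4))"

text \<open>In the following formulas \<open>s p\<close> stands for the chosen branch of \<open>sqrt (p^3 * (p + 4))\<close>.\<close>

definition x_fun :: "(complex \<Rightarrow> complex) \<Rightarrow> complex \<Rightarrow> complex" where
  "x_fun s p = ((p^2 + 2*p - 2) + s p) / (2 * s p)"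

definition y0_fun :: "(complex \<Rightarrow> complex) \<Rightarrow> complex \<Rightarrow> complex" where
  "y0_fun s p = ((p^2 + 2*p) + s p) / (2 * s p)"

definition y_fun :: "(complex \<Rightarrow> complex) \<Rightarrow> complex \<Rightarrow> complex" where
  "y_fun s p = (p^2 + 2*p + s p) * (- (p^2) - 4*p + 3 * s p) / (4 * p * (p + 1) * s p)"

end

(* Everything is explicit in p: dx/dp = 6 / (s p (p + 4)) never vanishes, so x(p) is locally
   invertible and d/dx = (s p (p + 4) / 6) d/dp.  The polynomials x (x - 1), y (y - 1) and y - x
   factor completely over p and s, and for both parameter sets beta = - gamma, so the right-hand
   side of the equation depends on x and y only through these products, 2 x - 1 and 2 y - 1.
   After inserting s^2 = p^3 (p + 4) both sides are s times a rational function of p. *)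
theory Submission
  imports Defs
begin

section \<open>Local inverses and differentiation with respect to x through the parameter p\<close>

lemma local_inverse_exists:
  assumes "open E" and X: "X holomorphic_on E" and "p \<in> E" and "deriv X p \<noteq> 0"
  shows "\<exists>V T q. p \<in> V \<and> V \<subseteq> E \<and> local_inverse X V T q"
proof -
  obtain r where r: "r > 0" "ball p r \<subseteq> E" "inj_on X (ball p r)"
    using has_complex_derivative_locally_injective[OF X \<open>p \<in> E\<close> \<open>open E\<close> \<open>deriv X p \<noteq> 0\<close>]
    by blast
  have hol: "X holomorphic_on ball p r"
    using X r(2) holomorphic_on_subset by blast
  obtain q where "homeomorphism (ball p r) (X ` ball p r) X q"
    using invariance_of_domain_homeomorphism[of "ball p r" X] r(3)
      holomorphic_on_imp_continuous_on[OF hol] by auto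
  moreover have "open (X ` ball p r)"
    using open_mapping_thm3[OF hol open_ball r(3)] .
  ultimately have "local_inverse X (ball p r) (X ` ball p r) q"
    by (simp add: local_inverse_def)
  then show ?thesis
    using r(1,2) by (metis centre_in_ball)
qed

text \<open>A \<open>local_inverse\<close> is by definition only a homeomorphism, so nothing is
  known about \<open>q\<close> beyond continuity. That suffices: continuity of \<open>q\<close> at
  \<open>t\<close> together with a nonzero derivative of \<open>X\<close> at \<open>q t\<close>
  gives the inverse function rule.\<close>

lemma local_inverse_has_field_derivative:
  assumes inv: "local_inverse X V T q" and "t \<in> T"
    and X: "(X has_field_derivative c) (at (q t))" and "c \<noteq> 0"
  shows "(q has_field_derivative 1 / c) (at t)"
proof -
  have hom: "homeomorphism V T X q" and T: "open T"
    using inv by (auto simp: local_inverse_def)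
  have "isCont q t"
    using hom T \<open>t \<in> T\<close> by (simp add: homeomorphism_def continuous_on_eq_continuous_at)
  then have "(q has_field_derivative inverse c) (at t)"
    using X hom T assms(2,4)
    by (intro has_field_derivative_inverse_basic[of X c q t T]) (auto simp: homeomorphism_def)
  then show ?thesis
    by (simp add: inverse_eq_divide)
qed

text \<open>Reduces the equation to identities in p alone. \<open>Y1\<close> and \<open>Y2\<close>
  are dy/dx and its x-derivative written as functions of p; carrying the factor \<open>X'\<close> on
  the derivatives in p avoids quotients, since it cancels against dq/dx = 1 /
  \<open>X'\<close>.\<close>

lemma PVI_parametric_solutionI:
  assumes D: "open D"
    and X: "\<And>p. p \<in> D \<Longrightarrow> (X has_field_derivative X' p) (at p)"
    and X'_nonzero: "\<And>p. p \<in> D \<Longrightarrow> X' p \<noteq> 0"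
    and Y: "\<And>p. p \<in> D \<Longrightarrow> (Y has_field_derivative Y1 p * X' p) (at p)"
    and Y1: "\<And>p. p \<in> D \<Longrightarrow> (Y1 has_field_derivative Y2 p * X' p) (at p)"
    and eq: "\<And>p. p \<in> D \<Longrightarrow> PVI_defined (X p) (Y p)
               \<Longrightarrow> Y2 p = PVI_rhs \<alpha> \<beta> \<gamma> \<delta> (X p) (Y p) (Y1 p)"
  shows "PVI_parametric_solution \<alpha> \<beta> \<gamma> \<delta> D X Y"
  unfolding PVI_parametric_solution_def
proof (intro conjI ballI impI allI)
  fix p assume p: "p \<in> D" "PVI_defined (X p) (Y p)"
  define E where "E = {v \<in> D. PVI_defined (X v) (Y v)}"
  have contX: "continuous_on D X" and contY: "continuous_on D Y"
    using X Y by (meson DERIV_isCont continuous_at_imp_continuous_on)+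
  \<comment> \<open>Multiplying the five quantities that must not vanish turns the singular loci
    into the zero set of one continuous function, hence \<open>E\<close> is open and a local inverse
    can be sought inside it.\<close>
  have "E = D \<inter> (\<lambda>v. X v * (X v - 1) * Y v * (Y v - 1) * (Y v - X v)) -` (- {0})"
    by (auto simp: E_def PVI_defined_def)
  moreover have "open \<dots>"
    by (intro continuous_open_preimage continuous_intros contX contY D)
  ultimately have "open E"
    by simp
  moreover have "X holomorphic_on E"
    using X \<open>open E\<close> by (subst holomorphic_on_open) (auto simp: E_def)
  moreover have "deriv X p \<noteq> 0"
    using DERIV_imp_deriv[OF X[OF p(1)]] X'_nonzero[OF p(1)] by simp
  ultimately obtain V T q where "p \<in> V" "V \<subseteq> E" "local_inverse X V T q"
    using local_inverse_exists[of E X p] p by (auto simp: E_def)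
  then show "\<exists>V T q. p \<in> V \<and> V \<subseteq> D \<and> (\<forall>v\<in>V. PVI_defined (X v) (Y v)) \<and> local_inverse X V T q"
    unfolding E_def by blast
next
  fix V T q
  assume "V \<subseteq> D \<and> (\<forall>v\<in>V. PVI_defined (X v) (Y v)) \<and> local_inverse X V T q"
  then have V: "V \<subseteq> D" "\<And>v. v \<in> V \<Longrightarrow> PVI_defined (X v) (Y v)"
    and inv: "local_inverse X V T q"
    by auto
  then have T: "open T" and Xq: "\<And>t. t \<in> T \<Longrightarrow> X (q t) = t" and qV: "\<And>t. t \<in> T \<Longrightarrow> q t \<in> V"
    by (auto simp: local_inverse_def homeomorphism_def)
  \<comment> \<open>Chain rule in the form used twice below: the derivative of \<open>q\<close> is
    the reciprocal of \<open>X' (q t)\<close>, which leaves exactly \<open>c\<close>.\<close>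
  have chain: "((\<lambda>t. F (q t)) has_field_derivative c) (at t)"
    if "t \<in> T" "(F has_field_derivative c * X' (q t)) (at (q t))" for F c t
  proof -
    have "q t \<in> D"
      using that(1) qV V by blast
    then show ?thesis
      using DERIV_chain2[OF that(2) local_inverse_has_field_derivative[OF inv that(1) X X'_nonzero]]
        X'_nonzero by simp
  qed
  have d1: "((\<lambda>t. Y (q t)) has_field_derivative Y1 (q t)) (at t)" if "t \<in> T" for t
    using that qV V by (intro chain Y) auto
  have d2: "((\<lambda>t. Y1 (q t)) has_field_derivative Y2 (q t)) (at t)" if "t \<in> T" for t
    using that qV V by (intro chain Y1) auto
  have deriv1: "deriv (Y \<circ> q) t = Y1 (q t)" if "t \<in> T" for t
    using DERIV_imp_deriv[OF d1[OF that]] by (simp add: o_def)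
  have deriv2: "deriv (deriv (Y \<circ> q)) t = Y2 (q t)" if "t \<in> T" for t
  proof -
    \<comment> \<open>The first derivative is known to be \<open>Y1 (q t)\<close> only for
      \<open>t\<close> in \<open>T\<close>; openness of \<open>T\<close> is what permits
      differentiating this equality.\<close>
    have "(deriv (Y \<circ> q) has_field_derivative Y2 (q t)) (at t)"
      using d2[OF that] T that
      by (rule has_field_derivative_transform_within_open) (simp add: deriv1)
    then show ?thesis
      by (rule DERIV_imp_deriv)
  qed
  have "(Y \<circ> q) holomorphic_on T"
    using d1 T by (subst holomorphic_on_open) (auto simp: o_def)
  moreover have "PVI_defined t ((Y \<circ> q) t)" if "t \<in> T" for t
    using V(2)[OF qV[OF that]] Xq[OF that] by simp
  moreover have "deriv (deriv (Y \<circ> q)) t = PVI_rhs \<alpha> \<beta> \<gamma> \<delta> t ((Y \<circ> q) t) (deriv (Y \<circ> q) t)"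
    if "t \<in> T" for t
  proof -
    have "q t \<in> D"
      using V(1) qV[OF that] by blast
    from eq[OF this V(2)[OF qV[OF that]]] show ?thesis
      using that by (simp add: deriv1 deriv2 Xq)
  qed
  ultimately show "PVI_solution_on \<alpha> \<beta> \<gamma> \<delta> T (Y \<circ> q)"
    using T by (simp add: PVI_solution_on_def)
qed

section \<open>The right-hand side when the second and third parameters are opposite\<close>

text \<open>The substitution x to 1 - x, y to 1 - y sends the parameters to (\<alpha>, -\<gamma>,
  -\<beta>, \<delta>), so opposite middle parameters are the invariant case. The two middle terms
  then merge, because (x - 1) y^2 - x (y - 1)^2 = x (x - 1) - (y - x)^2.\<close>

lemma PVI_rhs_antisymmetric:
  assumes "PVI_defined x y"
    and "a = y * (y - 1)" "b = x * (x - 1)" "d = y - x"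
  shows "PVI_rhs \<alpha> (- \<beta>) \<beta> \<delta> x y y' =
    1/2 * ((2*y - 1) / a + 1/d) * y'^2 - ((2*x - 1) / b + 1/d) * y'
    + a * d / b^2 * (\<alpha> + \<beta> * ((b - d^2) / a^2) + \<delta> * (b / d^2))"
proof -
  have nz: "x \<noteq> 0" "x - 1 \<noteq> 0" "y \<noteq> 0" "y - 1 \<noteq> 0"
    using assms(1) by (auto simp: PVI_defined_def)
  have "1/y + 1/(y - 1) = (2*y - 1) / a" "1/x + 1/(x - 1) = (2*x - 1) / b"
    using nz by (auto simp: assms(2,3) divide_simps)
  moreover have "- \<beta> * (x / y^2) + \<beta> * ((x - 1) / (y - 1)^2) = \<beta> * ((b - d^2) / a^2)"
  proof -
    have "- (x / y^2) + (x - 1) / (y - 1)^2 = (- x * (y - 1)^2 + (x - 1) * y^2) / a^2"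
      using nz by (simp add: assms(2) divide_simps power_mult_distrib)
    also have "- x * (y - 1)^2 + (x - 1) * y^2 = b - d^2"
      by (simp add: assms(3,4) power2_eq_square algebra_simps)
    finally show ?thesis
      by (metis (no_types, lifting) distrib_left mult_minus_left mult_minus_right)
  qed
  ultimately show ?thesis
    unfolding PVI_rhs_def assms(2-4)[symmetric]
    by (simp add: assms(2-4) power_mult_distrib add.assoc)
qed

text \<open>The syntactic shape reached once every quotient is rewritten as the branch value times a
  rational function of p; used as a rewrite rule to pull that value out.\<close>

lemma PVI_rhs_factor_out:
  fixes r :: complex
  shows "1/2 * (r * A + r * B) * w^2 - (r * C + r * B) * w + r * E * G
    = r * (1/2 * (A + B) * w^2 - (C + B) * w + E * G)"
  by (simp add: algebra_simps)

section \<open>The branch of the square root, closed forms, and derivatives in p\<close>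

context
  fixes D :: "complex set" and s :: "complex \<Rightarrow> complex"
  assumes s: "sqrt_branch_on D s"
begin

lemma s_square: "p \<in> D \<Longrightarrow> (s p)^2 = p^3 * (p + 4)"
  using s by (simp add: sqrt_branch_on_def)

lemma s_nonzero_imp: "p \<in> D \<Longrightarrow> s p \<noteq> 0 \<Longrightarrow> p \<noteq> 0 \<and> p + 4 \<noteq> 0"
  using s_square[of p] by auto

text \<open>Differentiating s^2 = p^3 (p + 4) gives 2 s s' = 4 p^2 (p + 3), so the logarithmic
  derivative of \<open>s\<close> is rational in p.\<close>

lemma s_has_field_derivative:
  assumes "p \<in> D" "s p \<noteq> 0"
  shows "(s has_field_derivative 2 * (p + 3) * s p / (p * (p + 4))) (at p)"
proof -
  have "open D" "s holomorphic_on D"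
    using s by (auto simp: sqrt_branch_on_def)
  then have der: "(s has_field_derivative deriv s p) (at p)"
    using assms(1) holomorphic_derivI by blast
  then have "((\<lambda>v. (s v)^2) has_field_derivative 2 * s p * deriv s p) (at p)"
    by (auto intro!: derivative_eq_intros)
  moreover have "((\<lambda>v. (s v)^2) has_field_derivative 4 * p^2 * (p + 3)) (at p)"
  proof (rule has_field_derivative_transform_within_open)
    show "((\<lambda>v. v^3 * (v + 4)) has_field_derivative 4 * p^2 * (p + 3)) (at p)"
      by (auto intro!: derivative_eq_intros simp: algebra_simps power2_eq_square power3_eq_cube)
  qed (use assms(1) \<open>open D\<close> s_square in auto)
  ultimately have "2 * s p * deriv s p = 4 * p^2 * (p + 3)"
    by (rule DERIV_unique)
  \<comment> \<open>The extra factor p (p + 4) completes 4 p^2 (p + 3) to a multiple of p^3 (p + 4)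
    = s^2, after which one factor 2 s can be cancelled.\<close>
  then have "2 * s p * (deriv s p * (p * (p + 4))) = 4 * p^2 * (p + 3) * (p * (p + 4))"
    by (metis mult.assoc)
  also have "\<dots> = 2 * s p * (2 * (p + 3) * s p)"
    using s_square[OF assms(1)] by algebra
  finally have "deriv s p * (p * (p + 4)) = 2 * (p + 3) * s p"
    using assms(2) by (metis mult_left_cancel mult_eq_0_iff zero_neq_numeral)
  then have "deriv s p = 2 * (p + 3) * s p / (p * (p + 4))"
    using s_nonzero_imp[OF assms] by (simp add: eq_divide_eq)
  then show ?thesis
    using der by simp
qed

text \<open>All three functions have the form 1/2 + A / (2 s) with A rational in p. As s'/s is
  rational, one computation of the numerator \<open>N\<close> serves for each of them.\<close>

lemma half_plus_quotient_has_field_derivative: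
  assumes "p \<in> D" "s p \<noteq> 0" and "(A has_field_derivative A') (at p)"
    and "A' * (p * (p + 4)) - A p * (2 * (p + 3)) = N"
  shows "((\<lambda>v. 1/2 + A v / (2 * s v)) has_field_derivative N / (2 * s p * (p * (p + 4)))) (at p)"
proof -
  note nz = s_nonzero_imp[OF assms(1,2)]
  have "((\<lambda>v. 1/2 + A v / (2 * s v)) has_field_derivative
      (A' * (2 * s p) - A p * (2 * (2 * (p + 3) * s p / (p * (p + 4))))) / (2 * s p * (2 * s p)))
      (at p)"
    using assms by (auto intro!: derivative_eq_intros s_has_field_derivative)
  also have "(A' * (2 * s p) - A p * (2 * (2 * (p + 3) * s p / (p * (p + 4))))) / (2 * s p * (2 * s p))
      = (A' - A p * (2 * (p + 3)) / (p * (p + 4))) / (2 * s p)"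
    using assms(2) by (simp add: divide_simps) (simp add: algebra_simps)
  also have "A' - A p * (2 * (p + 3)) / (p * (p + 4)) = N / (p * (p + 4))"
    using nz by (simp add: assms(4)[symmetric] diff_divide_distrib)
  finally show ?thesis
    by (simp add: mult.commute)
qed

lemma x_fun_eq: "s p \<noteq> 0 \<Longrightarrow> x_fun s p = 1/2 + (p^2 + 2*p - 2) / (2 * s p)"
  by (simp add: x_fun_def add_divide_distrib)

lemma y0_fun_eq: "s p \<noteq> 0 \<Longrightarrow> y0_fun s p = 1/2 + (p^2 + 2*p) / (2 * s p)"
  by (simp add: y0_fun_def add_divide_distrib)

lemma y_fun_eq:
  assumes "p \<in> D" "s p \<noteq> 0" "p + 1 \<noteq> 0"
  shows "y_fun s p = 1/2 + p * (p + 4) * (p - 1) / (p + 1) / (2 * s p)"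
proof -
  have "(p^2 + 2*p + s p) * (- (p^2) - 4*p + 3 * s p)
      = 2 * p * ((p + 1) * s p + p * (p + 4) * (p - 1))"
    using s_square[OF assms(1)] by algebra
  then show ?thesis
    using assms s_nonzero_imp[OF assms(1,2)] by (simp add: y_fun_def divide_simps)
qed

lemma open_nonzero: "open {p \<in> D. p \<noteq> 0 \<and> s p \<noteq> 0}"
proof -
  have "{p \<in> D. p \<noteq> 0 \<and> s p \<noteq> 0} = D \<inter> (\<lambda>p. p * s p) -` (- {0})"
    by auto
  moreover have "open \<dots>"
    using s by (intro continuous_open_preimage continuous_intros)
      (auto simp: sqrt_branch_on_def holomorphic_on_imp_continuous_on)
  ultimately show ?thesis
    by simp
qed

lemma x_fun_has_field_derivative:
  assumes "p \<in> D" "s p \<noteq> 0"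
  shows "(x_fun s has_field_derivative 6 / (s p * p * (p + 4))) (at p)"
\<comment> \<open>The closed form agrees with \<open>x_fun\<close> only where \<open>s\<close> does
  not vanish: at a zero of \<open>s\<close> division by zero gives 0 for \<open>x_fun\<close> but
  1/2 for the closed form. Hence the transfer along an open set.\<close>
proof (rule has_field_derivative_transform_within_open[where S = "{p \<in> D. p \<noteq> 0 \<and> s p \<noteq> 0}"])
  have A: "((\<lambda>v. v^2 + 2 * v - 2) has_field_derivative 2*p + 2) (at p)"
    by (auto intro!: derivative_eq_intros)
  \<comment> \<open>The numerator is a nonzero constant, which is why dx/dp has no zeros.\<close>
  have "(2*p + 2) * (p * (p + 4)) - (p^2 + 2*p - 2) * (2 * (p + 3)) = 12"
    by (simp add: algebra_simps power2_eq_square)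
  note half_plus_quotient_has_field_derivative[OF assms A this]
  also have "12 / (2 * s p * (p * (p + 4))) = 6 / (s p * p * (p + 4))"
    using assms s_nonzero_imp[OF assms] by (simp add: divide_simps)
  finally show "((\<lambda>v. 1/2 + (v^2 + 2 * v - 2) / (2 * s v)) has_field_derivative
      6 / (s p * p * (p + 4))) (at p)" .
qed (use assms s_nonzero_imp[OF assms] open_nonzero in \<open>auto simp: x_fun_eq\<close>)

lemma y0_fun_has_field_derivative:
  assumes "p \<in> D" "s p \<noteq> 0"
  shows "(y0_fun s has_field_derivative - p / 3 * (6 / (s p * p * (p + 4)))) (at p)"
proof (rule has_field_derivative_transform_within_open[where S = "{p \<in> D. p \<noteq> 0 \<and> s p \<noteq> 0}"])
  have A: "((\<lambda>v. v^2 + 2 * v) has_field_derivative 2*p + 2) (at p)"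
    by (auto intro!: derivative_eq_intros)
  have "(2*p + 2) * (p * (p + 4)) - (p^2 + 2*p) * (2 * (p + 3)) = - 4 * p"
    by algebra
  from half_plus_quotient_has_field_derivative[OF assms A this]
  show "((\<lambda>v. 1/2 + (v^2 + 2 * v) / (2 * s v)) has_field_derivative
          - p / 3 * (6 / (s p * p * (p + 4)))) (at p)"
    using s_nonzero_imp[OF assms] assms by (simp add: divide_simps)
qed (use assms s_nonzero_imp[OF assms] open_nonzero in \<open>auto simp: y0_fun_eq\<close>)

lemma open_nonzero': "open {p \<in> D. p \<noteq> 0 \<and> s p \<noteq> 0 \<and> p + 1 \<noteq> 0}"
proof -
  have "{p \<in> D. p \<noteq> 0 \<and> s p \<noteq> 0 \<and> p + 1 \<noteq> 0} = {p \<in> D. p \<noteq> 0 \<and> s p \<noteq> 0} - {- 1}"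
    by (auto simp: eq_neg_iff_add_eq_0)
  then show ?thesis
    using open_nonzero by (simp add: open_delete)
qed

lemma y_fun_has_field_derivative:
  assumes "p \<in> D" "s p \<noteq> 0" "p + 1 \<noteq> 0"
  shows "(y_fun s has_field_derivative
           (4*p + 1) * p * (p + 4) / (6 * (p + 1)^2) * (6 / (s p * p * (p + 4)))) (at p)"
proof (rule has_field_derivative_transform_within_open
    [where S = "{p \<in> D. p \<noteq> 0 \<and> s p \<noteq> 0 \<and> p + 1 \<noteq> 0}"])
  note nz = s_nonzero_imp[OF assms(1,2)]
  define A' where "A' = (2*p^3 + 6*p^2 + 6*p - 4) / (p + 1)^2"
  have num: "((\<lambda>v. v * (v + 4) * (v - 1)) has_field_derivative 3*p^2 + 6*p - 4) (at p)"
    by (rule derivative_eq_intros refl)+ (simp add: algebra_simps power2_eq_square)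
  have den: "((\<lambda>v. v + 1) has_field_derivative 1) (at p)"
    by (auto intro!: derivative_eq_intros)
  have "((\<lambda>v. v * (v + 4) * (v - 1) / (v + 1)) has_field_derivative
      ((3*p^2 + 6*p - 4) * (p + 1) - p * (p + 4) * (p - 1)) / (p + 1)^2) (at p)"
    using DERIV_divide[OF num den assms(3)] by (simp add: power2_eq_square)
  also have "(3*p^2 + 6*p - 4) * (p + 1) - p * (p + 4) * (p - 1) = 2*p^3 + 6*p^2 + 6*p - 4"
    by algebra
  finally have A: "((\<lambda>v. v * (v + 4) * (v - 1) / (v + 1)) has_field_derivative A') (at p)"
    by (simp add: A'_def)
  \<comment> \<open>Here A itself contains p (p + 4). Over the common denominator (p + 1)^2 this
    factor comes out of the whole numerator, and the cubic and quadratic terms of the rest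
    cancel.\<close>
  have "p * (p + 4) * (p - 1) / (p + 1) * (2 * (p + 3))
      = 2 * (p - 1) * (p + 3) * (p + 1) / (p + 1)^2 * (p * (p + 4))"
    using assms(3) by (simp add: divide_simps power2_eq_square) (simp add: algebra_simps)
  then have "A' * (p * (p + 4)) - p * (p + 4) * (p - 1) / (p + 1) * (2 * (p + 3))
      = ((2*p^3 + 6*p^2 + 6*p - 4) - 2 * (p - 1) * (p + 3) * (p + 1)) / (p + 1)^2 * (p * (p + 4))"
    by (simp only: A'_def diff_divide_distrib left_diff_distrib)
  also have "(2*p^3 + 6*p^2 + 6*p - 4) - 2 * (p - 1) * (p + 3) * (p + 1) = 2 * (4*p + 1)"
    by algebra
  finally have "((\<lambda>v. 1/2 + v * (v + 4) * (v - 1) / (v + 1) / (2 * s v)) has_field_derivative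
      2 * (4*p + 1) / (p + 1)^2 * (p * (p + 4)) / (2 * s p * (p * (p + 4)))) (at p)"
    by (rule half_plus_quotient_has_field_derivative[OF assms(1,2) A])
  also have "2 * (4*p + 1) / (p + 1)^2 * (p * (p + 4)) / (2 * s p * (p * (p + 4)))
      = (4*p + 1) * p * (p + 4) / (6 * (p + 1)^2) * (6 / (s p * p * (p + 4)))"
    using nz assms by (simp add: divide_simps)
  finally show "((\<lambda>v. 1/2 + v * (v + 4) * (v - 1) / (v + 1) / (2 * s v)) has_field_derivative
      (4*p + 1) * p * (p + 4) / (6 * (p + 1)^2) * (6 / (s p * p * (p + 4)))) (at p)" .
qed (use assms s_nonzero_imp[OF assms(1,2)] open_nonzero' in \<open>auto simp: y_fun_eq\<close>)

section \<open>Factorisations of the products that enter the right-hand side\<close>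

text \<open>With 2 x - 1 = A / s one has x (x - 1) = (A^2 - s^2) / (4 s^2), and the quartic and
  cubic terms of A^2 and s^2 = p^3 (p + 4) cancel. The next two lemmas use the same difference of
  squares.\<close>

lemma x_fun_products:
  assumes "p \<in> D" "s p \<noteq> 0"
  shows "x_fun s p * (x_fun s p - 1) = (1 - 2*p) / (s p)^2"
    and "2 * x_fun s p - 1 = (p^2 + 2*p - 2) / s p"
proof -
  have "x_fun s p * (x_fun s p - 1) = ((p^2 + 2*p - 2)^2 - (s p)^2) / (4 * (s p)^2)"
    using assms by (simp add: x_fun_eq field_simps power2_eq_square)
  also have "(p^2 + 2*p - 2)^2 - (s p)^2 = 4 * (1 - 2*p)"
    using s_square[OF assms(1)] by algebra
  finally show "x_fun s p * (x_fun s p - 1) = (1 - 2*p) / (s p)^2"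
    by (simp only: mult_divide_mult_cancel_left zero_neq_numeral[symmetric] not_False_eq_True)
  show "2 * x_fun s p - 1 = (p^2 + 2*p - 2) / s p"
    using assms by (simp add: x_fun_eq field_simps)
qed

lemma y0_fun_products:
  assumes "p \<in> D" "s p \<noteq> 0"
  shows "y0_fun s p * (y0_fun s p - 1) = p^2 / (s p)^2"
    and "2 * y0_fun s p - 1 = (p^2 + 2*p) / s p"
    and "y0_fun s p - x_fun s p = 1 / s p"
proof -
  have "y0_fun s p * (y0_fun s p - 1) = ((p^2 + 2*p)^2 - (s p)^2) / (4 * (s p)^2)"
    using assms by (simp add: y0_fun_eq field_simps power2_eq_square)
  also have "(p^2 + 2*p)^2 - (s p)^2 = 4 * p^2"
    using s_square[OF assms(1)] by algebra
  finally show "y0_fun s p * (y0_fun s p - 1) = p^2 / (s p)^2"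
    by simp
  show "2 * y0_fun s p - 1 = (p^2 + 2*p) / s p" "y0_fun s p - x_fun s p = 1 / s p"
    using assms by (simp_all add: y0_fun_eq x_fun_eq field_simps)
qed

lemma y_fun_products:
  assumes "p \<in> D" "s p \<noteq> 0" "p + 1 \<noteq> 0"
  shows "y_fun s p * (y_fun s p - 1) = p^2 * (p + 4) * (1 - 2*p) / ((p + 1)^2 * (s p)^2)"
    and "2 * y_fun s p - 1 = p * (p + 4) * (p - 1) / ((p + 1) * s p)"
    and "y_fun s p - x_fun s p = (1 - 2*p) / ((p + 1) * s p)"
proof -
  have eq: "y_fun s p = 1/2 + p * (p + 4) * (p - 1) / (2 * ((p + 1) * s p))"
    using y_fun_eq[OF assms] by (simp add: mult.left_commute)
  \<comment> \<open>Applied with \<open>v\<close> equal to (p + 1) s, so that the denominator p + 1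
    is absorbed.\<close>
  have half: "(1/2 + u / (2 * v)) * (1/2 + u / (2 * v) - 1) = (u^2 - v^2) / (4 * v^2)"
    if "v \<noteq> 0" for u v :: complex
    using that by (simp add: field_simps power2_eq_square)
  have "y_fun s p * (y_fun s p - 1)
      = ((p * (p + 4) * (p - 1))^2 - ((p + 1) * s p)^2) / (4 * ((p + 1) * s p)^2)"
    unfolding eq using assms by (intro half) simp
  also have "(p * (p + 4) * (p - 1))^2 - ((p + 1) * s p)^2 = 4 * (p^2 * (p + 4) * (1 - 2*p))"
    using s_square[OF assms(1)] by algebra
  finally show "y_fun s p * (y_fun s p - 1)
      = p^2 * (p + 4) * (1 - 2*p) / ((p + 1)^2 * (s p)^2)"
    by (simp add: power_mult_distrib)
  show "2 * y_fun s p - 1 = p * (p + 4) * (p - 1) / ((p + 1) * s p)"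
    unfolding eq by (simp add: divide_simps)
  have "x_fun s p = 1/2 + (p + 1) * (p^2 + 2*p - 2) / (2 * ((p + 1) * s p))"
    using assms by (simp add: x_fun_eq)
  then have "y_fun s p - x_fun s p
      = (p * (p + 4) * (p - 1) - (p + 1) * (p^2 + 2*p - 2)) / (2 * ((p + 1) * s p))"
    unfolding eq by (simp add: diff_divide_distrib)
  also have "p * (p + 4) * (p - 1) - (p + 1) * (p^2 + 2*p - 2) = 2 * (1 - 2*p)"
    by algebra
  finally show "y_fun s p - x_fun s p = (1 - 2*p) / ((p + 1) * s p)"
    by (simp only: mult_divide_mult_cancel_left zero_neq_numeral[symmetric] not_False_eq_True)
qed

section \<open>The Painleve VI identities as identities in p\<close>

text \<open>The left side is the second x-derivative: dy0/dx = - p / 3, differentiated in p and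
  divided by dx/dp.\<close>

lemma y0_fun_PVI:
  assumes "p \<in> D" "s p \<noteq> 0" and defd: "PVI_defined (x_fun s p) (y0_fun s p)"
  shows "- (s p * p * (p + 4)) / 18 = PVI_rhs 0 0 0 (1/2) (x_fun s p) (y0_fun s p) (- p / 3)"
proof -
  note nz = s_nonzero_imp[OF assms(1,2)]
  have "x_fun s p * (x_fun s p - 1) \<noteq> 0"
    using defd by (simp add: PVI_defined_def)
  then have k: "1 - 2*p \<noteq> 0"
    using x_fun_products(1)[OF assms(1,2)] by auto
  \<comment> \<open>A name for 1 - 2 p keeps it an opaque nonzero denominator until the closing
    polynomial identity.\<close>
  define k where "k = 1 - 2*p"
  have k0: "k \<noteq> 0"
    using k by (simp add: k_def)
  have "PVI_rhs 0 0 0 (1/2) (x_fun s p) (y0_fun s p) (- p / 3) =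
      s p * (1/2 * ((p + 2) / p + 1) * (- p / 3)^2
        - ((p^2 + 2*p - 2) / k + 1) * (- p / 3) + p^2 / k^2 * (1/2 * k))"
  proof -
    have e1: "((p^2 + 2*p) / s p) / (p^2 / (s p)^2) = s p * ((p + 2) / p)"
      using nz assms by (simp add: divide_simps power2_eq_square) (simp add: algebra_simps)
    \<comment> \<open>The trailing factor 1 is kept so that the term matches
      \<open>PVI_rhs_factor_out\<close>.\<close>
    have e2: "1 / (1 / s p) = s p * 1"
      by simp
    have e3: "((p^2 + 2*p - 2) / s p) / (k / (s p)^2) = s p * ((p^2 + 2*p - 2) / k)"
      using assms by (simp add: divide_simps power2_eq_square)
    have e4: "p^2 / (s p)^2 * (1 / s p) / (k / (s p)^2)^2 = s p * (p^2 / k^2)"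
      using assms by (simp add: divide_simps power2_eq_square)
    have e5: "k / (s p)^2 / (1 / s p)^2 = k"
      using assms by (simp add: divide_simps power2_eq_square)
    show ?thesis
      using PVI_rhs_antisymmetric[OF defd refl refl refl, of 0 0 "1/2" "- p / 3"]
      unfolding x_fun_products[OF assms(1,2)] y0_fun_products[OF assms(1,2)] k_def[symmetric]
        e1 e2 e3 e4 e5 PVI_rhs_factor_out by simp
  qed
  also have "1/2 * ((p + 2) / p + 1) * (- p / 3)^2
        - ((p^2 + 2*p - 2) / k + 1) * (- p / 3) + p^2 / k^2 * (1/2 * k)
      = (2 * p * (p + 1) * k + 6 * p * (p^2 + 2*p - 2 + k) + 9 * p^2) / (18 * k)"
    using nz k0 by (simp add: divide_simps power2_eq_square)
  \<comment> \<open>The numerator is divisible by \<open>k\<close>, which removes the apparent pole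
    at p = 1/2.\<close>
  also have "2 * p * (p + 1) * k + 6 * p * (p^2 + 2*p - 2 + k) + 9 * p^2 = - (p * (p + 4)) * k"
    unfolding k_def by algebra
  finally show ?thesis
    using k by (simp add: k_def[symmetric])
qed

lemma y_fun_PVI:
  assumes "p \<in> D" "s p \<noteq> 0" "p + 1 \<noteq> 0" and defd: "PVI_defined (x_fun s p) (y_fun s p)"
  shows "(2*p^3 + 6*p^2 + 15*p + 2) * (s p * p * (p + 4)) / (18 * (p + 1)^3) =
    PVI_rhs (1/8) (- 1/8) (1/8) (3/8) (x_fun s p) (y_fun s p)
      ((4*p + 1) * p * (p + 4) / (6 * (p + 1)^2))"
proof -
  note nz = s_nonzero_imp[OF assms(1,2)]
  have "x_fun s p * (x_fun s p - 1) \<noteq> 0"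
    using defd by (simp add: PVI_defined_def)
  then have k: "1 - 2*p \<noteq> 0"
    using x_fun_products(1)[OF assms(1,2)] by auto
  define k l m r where "k = 1 - 2*p" and "l = p + 1" and "m = p + 4" and "r = s p"
  have nz': "k \<noteq> 0" "l \<noteq> 0" "m \<noteq> 0" "r \<noteq> 0" "p \<noteq> 0"
    using k nz assms by (auto simp: k_def l_def m_def r_def)
  have r2: "r^2 = p^3 * m"
    using s_square[OF assms(1)] by (simp add: r_def m_def)
  define w where "w = (4*p + 1) * p * m / (6 * l^2)"
  have "PVI_rhs (1/8) (- 1/8) (1/8) (3/8) (x_fun s p) (y_fun s p) w =
      r * (1/2 * ((p - 1) * l / (p * k) + l / k) * w^2
        - ((p^2 + 2*p - 2) / k + l / k) * w + p^2 * m / l^3 * (1/8 + 1/8 * (l^2 / k) + 3/8 * (l^2 / k)))"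
  proof -
    \<comment> \<open>In the notation of \<open>PVI_rhs_antisymmetric\<close> this is b - d^2. Since
      l^2 - k = p m, the quotient (b - d^2) / a^2 turns out equal to b / d^2, both being l^2 / k
      (\<open>e4\<close> and \<open>e5\<close>).\<close>
    have "k / r^2 - (k / (l * r))^2 = (k * (l^2 - k)) / (l^2 * r^2)"
      using nz' by (simp add: field_simps power2_eq_square)
    also have "l^2 - k = p * m"
      unfolding k_def l_def m_def by algebra
    finally have "(k / r^2 - (k / (l * r))^2) / (p^2 * m * k / (l^2 * r^2))^2
        = l^2 * r^2 / (p^3 * m * k)"
      using nz' by (simp add: divide_simps power2_eq_square power3_eq_cube)
    then have e4: "(k / r^2 - (k / (l * r))^2) / (p^2 * m * k / (l^2 * r^2))^2 = l^2 / k"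
      using nz' by (simp add: r2)
    have e1: "(p * m * (p - 1) / (l * r)) / (p^2 * m * k / (l^2 * r^2)) = r * ((p - 1) * l / (p * k))"
      using nz' by (simp add: divide_simps power2_eq_square)
    have e2: "1 / (k / (l * r)) = r * (l / k)"
      by simp
    have e3: "((p^2 + 2*p - 2) / r) / (k / r^2) = r * ((p^2 + 2*p - 2) / k)"
      using nz' by (simp add: divide_simps power2_eq_square)
    have e5: "(k / r^2) / (k / (l * r))^2 = l^2 / k"
      using nz' by (simp add: divide_simps power2_eq_square)
    have e6: "p^2 * m * k / (l^2 * r^2) * (k / (l * r)) / (k / r^2)^2 = r * (p^2 * m / l^3)"
      using nz' by (simp add: divide_simps power2_eq_square power3_eq_cube)
    show ?thesis
      using PVI_rhs_antisymmetric[OF defd refl refl refl, of "1/8" "1/8" "3/8" w]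
      unfolding x_fun_products[OF assms(1,2)] y_fun_products[OF assms(1-3)]
        k_def[symmetric] l_def[symmetric] m_def[symmetric] r_def[symmetric] e1 e2 e3 e4 e5 e6
        PVI_rhs_factor_out by simp
  qed
  also have "1/2 * ((p - 1) * l / (p * k) + l / k) * w^2
        - ((p^2 + 2*p - 2) / k + l / k) * w + p^2 * m / l^3 * (1/8 + 1/8 * (l^2 / k) + 3/8 * (l^2 / k))
      = p * m * ((2*p - 1) * (4*p + 1)^2 * m - 12 * (p^2 + 2*p - 2 + l) * (4*p + 1) * l
          + 9 * p * (k + 4 * l^2)) / (72 * k * l^3)"
  \<comment> \<open>The three summands are brought separately over 72 k l^3: 72 = 2 * 6^2 comes from
    w^2 / 2, and 12 = 72 / 6 and 9 = 72 / 8 are the resulting cofactors.\<close>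
  proof -
    have "1/2 * ((p - 1) * l / (p * k) + l / k) * w^2
        = p * m * ((2*p - 1) * (4*p + 1)^2 * m) / (72 * k * l^3)"
    proof -
      have "(p - 1) * l / (p * k) + l / k = (2*p - 1) * l / (p * k)"
        using nz' by (simp add: divide_simps) (simp add: algebra_simps)
      then show ?thesis
        using nz' by (simp add: w_def divide_simps power2_eq_square power3_eq_cube)
    qed
    moreover have "((p^2 + 2*p - 2) / k + l / k) * w
        = p * m * (12 * (p^2 + 2*p - 2 + l) * (4*p + 1) * l) / (72 * k * l^3)"
      unfolding add_divide_distrib[symmetric]
      using nz' by (simp add: w_def divide_simps power2_eq_square power3_eq_cube)
    moreover have "p^2 * m / l^3 * (1/8 + 1/8 * (l^2 / k) + 3/8 * (l^2 / k))
        = p * m * (9 * p * (k + 4 * l^2)) / (72 * k * l^3)"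
    proof -
      have "1/8 + 1/8 * (l^2 / k) + 3/8 * (l^2 / k) = (k + 4 * l^2) / (8 * k)"
        using nz' by (simp add: divide_simps)
      then show ?thesis
        using nz' by (simp add: divide_simps power2_eq_square)
    qed
    ultimately show ?thesis
      by (simp only: add_divide_distrib[symmetric] diff_divide_distrib[symmetric]
          distrib_left[symmetric] right_diff_distrib[symmetric])
  qed
  \<comment> \<open>Again the bracket is divisible by \<open>k\<close>, and the cubic left over is
    the one in the second derivative.\<close>
  also have "(2*p - 1) * (4*p + 1)^2 * m - 12 * (p^2 + 2*p - 2 + l) * (4*p + 1) * l
          + 9 * p * (k + 4 * l^2) = 4 * k * (2*p^3 + 6*p^2 + 15*p + 2)"
    unfolding k_def l_def m_def by algebra
  also have "r * (p * m * (4 * k * (2*p^3 + 6*p^2 + 15*p + 2)) / (72 * k * l^3))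
      = (2*p^3 + 6*p^2 + 15*p + 2) * (r * p * m) / (18 * l^3)"
  proof -
    have "r * (p * m * (4 * k * N) / (72 * k * l^3)) = N * (r * p * m) / (18 * l^3)" for N
      using nz' by (simp add: divide_simps)
    then show ?thesis .
  qed
  finally show ?thesis
    unfolding w_def l_def m_def r_def by (rule sym)
qed

end

section \<open>Assembly from explicit first and second x-derivatives\<close>

theorem theorem5p2:
  fixes D :: "complex set" and s :: "complex \<Rightarrow> complex"
  assumes "sqrt_branch_on D s"
  shows "PVI_parametric_solution 0 0 0 (1/2)
           {p \<in> D. p \<noteq> 0 \<and> s p \<noteq> 0} (x_fun s) (y0_fun s) \<and>
         PVI_parametric_solution (1/8) (- 1/8) (1/8) (3/8)
           {p \<in> D. p \<noteq> 0 \<and> s p \<noteq> 0 \<and> p + 1 \<noteq> 0} (x_fun s) (y_fun s)"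
proof
  let ?X' = "\<lambda>p. 6 / (s p * p * (p + 4))"
  note nz = s_nonzero_imp[OF assms]
  show "PVI_parametric_solution 0 0 0 (1/2)
          {p \<in> D. p \<noteq> 0 \<and> s p \<noteq> 0} (x_fun s) (y0_fun s)"
  proof (rule PVI_parametric_solutionI[where X' = ?X' and ?Y1.0 = "\<lambda>p. - p / 3"
        and ?Y2.0 = "\<lambda>p. - (s p * p * (p + 4)) / 18"])
    fix p assume "p \<in> {p \<in> D. p \<noteq> 0 \<and> s p \<noteq> 0}"
    then have "- (s p * p * (p + 4)) / 18 * ?X' p = - 1 / 3"
      using nz[of p] by simp
    then show "((\<lambda>p. - p / 3) has_field_derivative
        - (s p * p * (p + 4)) / 18 * ?X' p) (at p)"
      by (auto intro!: derivative_eq_intros)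
  next
    fix p assume "p \<in> {p \<in> D. p \<noteq> 0 \<and> s p \<noteq> 0}"
    then have p: "p \<in> D" "s p \<noteq> 0"
      by auto
    show "(x_fun s has_field_derivative ?X' p) (at p)"
      using p by (rule x_fun_has_field_derivative[OF assms])
    show "?X' p \<noteq> 0"
      using p nz[of p] by simp
    show "(y0_fun s has_field_derivative - p / 3 * ?X' p) (at p)"
      using p by (rule y0_fun_has_field_derivative[OF assms])
    show "- (s p * p * (p + 4)) / 18 = PVI_rhs 0 0 0 (1/2) (x_fun s p) (y0_fun s p) (- p / 3)"
      if "PVI_defined (x_fun s p) (y0_fun s p)"
      using p that by (rule y0_fun_PVI[OF assms])
  qed (rule open_nonzero[OF assms])
  show "PVI_parametric_solution (1/8) (- 1/8) (1/8) (3/8)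
          {p \<in> D. p \<noteq> 0 \<and> s p \<noteq> 0 \<and> p + 1 \<noteq> 0} (x_fun s) (y_fun s)"
  \<comment> \<open>\<open>Y1\<close> is read off from \<open>y_fun_has_field_derivative\<close>;
    \<open>Y2\<close> is its p-derivative divided by dx/dp.\<close>
  proof (rule PVI_parametric_solutionI[where X' = ?X'
        and ?Y1.0 = "\<lambda>p. (4*p + 1) * p * (p + 4) / (6 * (p + 1)^2)"
        and ?Y2.0 = "\<lambda>p. (2*p^3 + 6*p^2 + 15*p + 2) * (s p * p * (p + 4)) / (18 * (p + 1)^3)"])
    fix p assume "p \<in> {p \<in> D. p \<noteq> 0 \<and> s p \<noteq> 0 \<and> p + 1 \<noteq> 0}"
    then have p: "s p * p * (p + 4) \<noteq> 0" "p + 1 \<noteq> 0"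
      using nz[of p] by auto
    have num: "((\<lambda>v. (4 * v + 1) * v * (v + 4)) has_field_derivative 12*p^2 + 34*p + 4) (at p)"
      by (auto intro!: derivative_eq_intros simp: algebra_simps power2_eq_square)
    have den: "((\<lambda>v. 6 * (v + 1)^2) has_field_derivative 12 * (p + 1)) (at p)"
      by (auto intro!: derivative_eq_intros)
    \<comment> \<open>The quotient-rule numerator has a factor p + 1, lowering the denominator from
      (p + 1)^4 to (p + 1)^3.\<close>
    have "(12*p^2 + 34*p + 4) * (6 * (p + 1)^2) - (4*p + 1) * p * (p + 4) * (12 * (p + 1))
        = 12 * (p + 1) * (2*p^3 + 6*p^2 + 15*p + 2)"
      by algebra
    moreover have "12 * l * N / (6 * l^2 * (6 * l^2)) = N / (3 * l^3)" if "l \<noteq> 0" for l N :: complex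
      using that by (simp add: divide_simps power2_eq_square power3_eq_cube)
    ultimately have "((12*p^2 + 34*p + 4) * (6 * (p + 1)^2)
          - (4*p + 1) * p * (p + 4) * (12 * (p + 1))) / (6 * (p + 1)^2 * (6 * (p + 1)^2))
        = (2*p^3 + 6*p^2 + 15*p + 2) / (3 * (p + 1)^3)"
      using p(2) by metis
    also have "\<dots> = (2*p^3 + 6*p^2 + 15*p + 2) * (s p * p * (p + 4)) / (18 * (p + 1)^3) * ?X' p"
      using p by simp
    finally show "((\<lambda>p. (4*p + 1) * p * (p + 4) / (6 * (p + 1)^2)) has_field_derivative
        (2*p^3 + 6*p^2 + 15*p + 2) * (s p * p * (p + 4)) / (18 * (p + 1)^3) * ?X' p) (at p)"
      using DERIV_divide[OF num den] p(2) by simp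
  next
    fix p assume "p \<in> {p \<in> D. p \<noteq> 0 \<and> s p \<noteq> 0 \<and> p + 1 \<noteq> 0}"
    then have p: "p \<in> D" "s p \<noteq> 0" "p + 1 \<noteq> 0"
      by auto
    show "(x_fun s has_field_derivative ?X' p) (at p)"
      using p(1,2) by (rule x_fun_has_field_derivative[OF assms])
    show "?X' p \<noteq> 0"
      using p nz[of p] by simp
    show "(y_fun s has_field_derivative
        (4*p + 1) * p * (p + 4) / (6 * (p + 1)^2) * ?X' p) (at p)"
      using p by (rule y_fun_has_field_derivative[OF assms])
    show "(2*p^3 + 6*p^2 + 15*p + 2) * (s p * p * (p + 4)) / (18 * (p + 1)^3) =
        PVI_rhs (1/8) (- 1/8) (1/8) (3/8) (x_fun s p) (y_fun s p)
          ((4*p + 1) * p * (p + 4) / (6 * (p + 1)^2))"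
      if "PVI_defined (x_fun s p) (y_fun s p)"
      using p that by (rule y_fun_PVI[OF assms])
  qed (rule open_nonzero'[OF assms])
qed

end
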